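(* Let $G$ be a graph of minimum degree greater than or equal to two and order $n$. The following statements hold. (i) For any graph $H$, $\gamma_{\times 2}(G\circ H)\leq \gamma_{2,t}(G)$. (ii) For any graph $H$, $\gamma_{\times 2}(G\circ H)\leq n$.
   Context: All graphs are finite, undirected, without loops or multiple edges, and have at least one vertex. The order of a graph is its number of vertices. The lexicographic product $G\circ H$ has vertex set $V(G)\times V(H)$, and $(u,v)$ is adjacent to $(x,y)$ if and only if $ux\in E(G)$, or $u=x$ and $vy\in E(H)$. A vertex dominates itself and its neighbours. For a graph $F$ with no isolated vertex, $\gamma_{\times 2}(F)$ is the minimum cardinality of a double dominating set of $F$, i.e. a set $S\subseteq V(F)$ such that every vertex of $F$ is dominated by at least two vertices of $S$. For a graph $F$ of minimum degree at least two, $\gamma_{2,t}(F)$ is the minimum cardinality of a double total dominating set of $F$, i.e. a set $S\subseteq V(F)$ such that every vertex of $F$ is adjacent to at least two vertices in $S$. *)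

theory Defs
  imports "Graph_Theory.Graph_Theory"
begin

text \<open>
  A finite simple undirected graph is a \<^locale>\<open>pair_graph\<close>: an edge \<open>uv\<close> is stored as the
  two arcs \<open>(u, v)\<close> and \<open>(v, u)\<close>. The locale admits the null graph, so nonemptiness of
  \<^term>\<open>pverts G\<close> is always assumed separately. As the arcs are symmetric, the degree of a
  vertex is its \<^const>\<open>out_degree\<close>.
\<close>

definition min_degree :: "'a pair_pre_digraph \<Rightarrow> nat" where
  "min_degree G = Min (out_degree (with_proj G) ` pverts G)"

definition lexicographic_product ::
    "'a pair_pre_digraph \<Rightarrow> 'b pair_pre_digraph \<Rightarrow> ('a \<times> 'b) pair_pre_digraph" where
  "lexicographic_product G H =
    \<lparr> pverts = pverts G \<times> pverts H,
      parcs = {((u, v), (x, y)) | u v x y.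
        (u, v) \<in> pverts G \<times> pverts H \<and> (x, y) \<in> pverts G \<times> pverts H \<and>
        ((u, x) \<in> parcs G \<or> u = x \<and> (v, y) \<in> parcs H)} \<rparr>"

definition vertex_dominates :: "'a pair_pre_digraph \<Rightarrow> 'a \<Rightarrow> 'a \<Rightarrow> bool" where
  "vertex_dominates F u v \<longleftrightarrow> u = v \<or> (u, v) \<in> parcs F"

definition double_dominating_set :: "'a pair_pre_digraph \<Rightarrow> 'a set \<Rightarrow> bool" where
  "double_dominating_set F S \<longleftrightarrow>
    S \<subseteq> pverts F \<and> (\<forall>v\<in>pverts F. 2 \<le> card {s \<in> S. vertex_dominates F s v})"

definition double_total_dominating_set :: "'a pair_pre_digraph \<Rightarrow> 'a set \<Rightarrow> bool" where
  "double_total_dominating_set F S \<longleftrightarrow>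
    S \<subseteq> pverts F \<and> (\<forall>v\<in>pverts F. 2 \<le> card {s \<in> S. (v, s) \<in> parcs F})"

text \<open>
  The minima below are meaningful only if a set of the required kind exists; see
  \<open>double_domination_number_attained\<close> and \<open>double_total_domination_number_attained\<close>.
\<close>

definition double_domination_number :: "'a pair_pre_digraph \<Rightarrow> nat" where
  "double_domination_number F = Min (card ` {S. double_dominating_set F S})"

definition double_total_domination_number :: "'a pair_pre_digraph \<Rightarrow> nat" where
  "double_total_domination_number F = Min (card ` {S. double_total_dominating_set F S})"

lemma out_degree_pair: "out_degree (with_proj G) v = card {u. (v, u) \<in> parcs G}"
proof -
  have "out_arcs (with_proj G) v = Pair v ` {u. (v, u) \<in> parcs G}"
    by (auto simp: out_arcs_def)
  then show ?thesis
    by (simp add: out_degree_def card_image inj_on_def)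
qed

lemma min_degree_ge_iff:
  assumes "pair_graph G" "pverts G \<noteq> {}"
  shows "k \<le> min_degree G \<longleftrightarrow> (\<forall>v\<in>pverts G. k \<le> card {u. (v, u) \<in> parcs G})"
proof -
  interpret pair_graph G by fact
  show ?thesis
    using assms(2) by (simp add: min_degree_def out_degree_pair pair_finite_verts)
qed

lemma pair_graph_lexicographic_product:
  assumes "pair_graph G" "pair_graph H"
  shows "pair_graph (lexicographic_product G H)"
proof -
  interpret G: pair_graph G by fact
  interpret H: pair_graph H by fact
  have sub: "parcs (lexicographic_product G H) \<subseteq> (pverts G \<times> pverts H) \<times> (pverts G \<times> pverts H)"
    by (auto simp: lexicographic_product_def)
  have fin: "finite (parcs (lexicographic_product G H))"
    by (rule finite_subset[OF sub]) (simp add: G.pair_finite_verts H.pair_finite_verts)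
  have wf: "pair_wf_digraph (lexicographic_product G H)"
    by unfold_locales (auto simp: lexicographic_product_def)
  have "symmetric (with_proj (lexicographic_product G H))"
    unfolding symmetric_def with_proj_simps sym_def
    by (auto simp: lexicographic_product_def dest: G.arcs_symmetric H.arcs_symmetric)
  moreover have "fst e \<noteq> snd e" if "e \<in> parcs (lexicographic_product G H)" for e
    using that by (auto simp: lexicographic_product_def dest: G.no_loops' H.no_loops')
  moreover have "finite (pverts (lexicographic_product G H))"
    by (simp add: lexicographic_product_def G.pair_finite_verts H.pair_finite_verts)
  ultimately show ?thesis
    using fin wf
    by (simp add: pair_graph_def pair_digraph_def pair_fin_digraph_def pair_fin_digraph_axioms_def
        pair_loopfree_digraph_def pair_loopfree_digraph_axioms_def pair_pseudo_graph_def
        pair_sym_digraph_def pair_sym_digraph_axioms_def)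
qed

lemma no_isolated_lexicographic_product:
  assumes "pair_graph G" "pair_graph H" "\<forall>u\<in>pverts G. \<exists>x. (u, x) \<in> parcs G"
  shows "\<forall>p\<in>pverts (lexicographic_product G H). \<exists>q. (p, q) \<in> parcs (lexicographic_product G H)"
proof -
  interpret G: pair_graph G by fact
  show ?thesis
  proof
    fix p assume p: "p \<in> pverts (lexicographic_product G H)"
    then obtain u v where uv: "p = (u, v)" "u \<in> pverts G" "v \<in> pverts H"
      by (auto simp: lexicographic_product_def)
    then obtain x where "(u, x) \<in> parcs G" using assms(3) by blast
    with uv have "(p, (x, v)) \<in> parcs (lexicographic_product G H)"
      by (auto simp: lexicographic_product_def dest: G.in_arcsD2)
    then show "\<exists>q. (p, q) \<in> parcs (lexicographic_product G H)" ..
  qed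
qed

lemma double_dominating_set_pverts:
  assumes "pair_graph F" "\<forall>v\<in>pverts F. \<exists>u. (v, u) \<in> parcs F"
  shows "double_dominating_set F (pverts F)"
proof -
  interpret pair_graph F by fact
  have "2 \<le> card {s \<in> pverts F. vertex_dominates F s v}" if v: "v \<in> pverts F" for v
  proof -
    obtain u where u: "(v, u) \<in> parcs F" using assms(2) v by blast
    then have "{v, u} \<subseteq> {s \<in> pverts F. vertex_dominates F s v}" "v \<noteq> u"
      using v by (auto simp: vertex_dominates_def dest: arcs_symmetric no_loops' in_arcsD2)
    moreover have "finite {s \<in> pverts F. vertex_dominates F s v}"
      by (simp add: pair_finite_verts)
    ultimately show ?thesis by (metis card_2_iff card_mono)
  qed
  then show ?thesis by (simp add: double_dominating_set_def)
qed

lemma double_total_dominating_set_pverts: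
  assumes "pair_graph F" "pverts F \<noteq> {}" "2 \<le> min_degree F"
  shows "double_total_dominating_set F (pverts F)"
proof -
  interpret pair_graph F by fact
  have "{s \<in> pverts F. (v, s) \<in> parcs F} = {u. (v, u) \<in> parcs F}" for v
    by (auto dest: in_arcsD2)
  then show ?thesis
    using assms by (simp add: double_total_dominating_set_def min_degree_ge_iff)
qed

lemma double_domination_number_attained:
  assumes "pair_graph F" "\<forall>v\<in>pverts F. \<exists>u. (v, u) \<in> parcs F"
  shows "\<exists>S. double_dominating_set F S \<and> card S = double_domination_number F"
    and "\<And>S. double_dominating_set F S \<Longrightarrow> double_domination_number F \<le> card S"
proof -
  interpret pair_graph F by fact
  have fin: "finite {S. double_dominating_set F S}"
    by (rule finite_subset[of _ "Pow (pverts F)"])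
      (auto simp: double_dominating_set_def pair_finite_verts)
  have "double_domination_number F \<in> card ` {S. double_dominating_set F S}"
    unfolding double_domination_number_def
    using fin double_dominating_set_pverts[OF assms] by (intro Min_in) auto
  then show "\<exists>S. double_dominating_set F S \<and> card S = double_domination_number F" by auto
  show "\<And>S. double_dominating_set F S \<Longrightarrow> double_domination_number F \<le> card S"
    unfolding double_domination_number_def using fin by (intro Min_le) auto
qed

lemma double_total_domination_number_attained:
  assumes "pair_graph F" "pverts F \<noteq> {}" "2 \<le> min_degree F"
  shows "\<exists>S. double_total_dominating_set F S \<and> card S = double_total_domination_number F"
    and "\<And>S. double_total_dominating_set F S \<Longrightarrow> double_total_domination_number F \<le> card S"
proof -
  interpret pair_graph F by fact
  have fin: "finite {S. double_total_dominating_set F S}"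
    by (rule finite_subset[of _ "Pow (pverts F)"])
      (auto simp: double_total_dominating_set_def pair_finite_verts)
  have "double_total_domination_number F \<in> card ` {S. double_total_dominating_set F S}"
    unfolding double_total_domination_number_def
    using fin double_total_dominating_set_pverts[OF assms] by (intro Min_in) auto
  then show "\<exists>S. double_total_dominating_set F S \<and> card S = double_total_domination_number F"
    by auto
  show "\<And>S. double_total_dominating_set F S \<Longrightarrow> double_total_domination_number F \<le> card S"
    unfolding double_total_domination_number_def using fin by (intro Min_le) auto
qed

end

theory Submission
  imports Defs
begin

text \<open>An edge us of G joins \<open>(s, h)\<close> to \<open>(u, v)\<close> in the product
  whatever h and v are. Hence a double total dominating set S of G, copied into a single layer over
  a fixed vertex h of H, gives every vertex \<open>(u, v)\<close> two neighbours: the copies of two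
  neighbours of u in S. So \<open>S \<times> {h}\<close> is a double dominating set of the product
  with as many elements as S. A minimum S gives (i). The whole vertex set of G qualifies as S
  because the minimum degree is at least two, which gives (ii).\<close>

lemma double_dominating_set_lexicographic_product:
  assumes G: "pair_graph G" and S: "double_total_dominating_set G S" and h: "h \<in> pverts H"
  shows "double_dominating_set (lexicographic_product G H) (S \<times> {h})"
proof -
  interpret pair_graph G by fact
  have sub: "S \<subseteq> pverts G"
    using S by (simp add: double_total_dominating_set_def)
  then have fin: "finite S"
    using finite_subset pair_finite_verts by blast
  have "2 \<le> card {s \<in> S \<times> {h}. vertex_dominates (lexicographic_product G H) s (u, v)}"
    if uv: "u \<in> pverts G" "v \<in> pverts H" for u v
  proof -
    have "2 \<le> card {s \<in> S. (u, s) \<in> parcs G}"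
      using S uv by (simp add: double_total_dominating_set_def)
    also have "\<dots> = card ({s \<in> S. (u, s) \<in> parcs G} \<times> {h})"
      by (simp add: card_cartesian_product)
    also have "\<dots> \<le> card {s \<in> S \<times> {h}. vertex_dominates (lexicographic_product G H) s (u, v)}"
    \<comment> \<open>Each \<open>(s, h)\<close> on the left dominates \<open>(u, v)\<close> through
      the arc from s to u, the reverse of the arc from u to s given by S; this is where symmetry of
      G enters.\<close>
    proof (rule card_mono)
      show "{s \<in> S. (u, s) \<in> parcs G} \<times> {h}
          \<subseteq> {s \<in> S \<times> {h}. vertex_dominates (lexicographic_product G H) s (u, v)}"
        using sub uv h
        by (auto simp: vertex_dominates_def lexicographic_product_def dest: arcs_symmetric)
    qed (simp add: fin)
    finally show ?thesis .
  qed
  with sub h show ?thesis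
    by (auto simp: double_dominating_set_def lexicographic_product_def)
qed

text \<open>S is left arbitrary so that both bounds of the theorem are instances. The size is
  preserved because the layer over h is a bijective copy of S.\<close>

lemma double_domination_number_lexicographic_product_le:
  assumes G: "pair_graph G" "pverts G \<noteq> {}" "2 \<le> min_degree G"
    and H: "pair_graph H" "pverts H \<noteq> {}"
    and S: "double_total_dominating_set G S"
  shows "double_domination_number (lexicographic_product G H) \<le> card S"
proof -
  obtain h where "h \<in> pverts H" using H by blast
  then have dom: "double_dominating_set (lexicographic_product G H) (S \<times> {h})"
    by (rule double_dominating_set_lexicographic_product[OF G(1) S])
  \<comment> \<open>The absence of isolated vertices passes from G to the product, where
    \<open>double_domination_number_attained\<close> asks for it.\<close>
  have "\<forall>u\<in>pverts G. \<exists>x. (u, x) \<in> parcs G"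
  proof
    fix u assume "u \<in> pverts G"
    then have "2 \<le> card {x. (u, x) \<in> parcs G}"
      using G min_degree_ge_iff by blast
    then show "\<exists>x. (u, x) \<in> parcs G"
      by (metis card.empty Collect_empty_eq not_numeral_le_zero)
  qed
  then have "double_domination_number (lexicographic_product G H) \<le> card (S \<times> {h})"
    using G H dom
    by (intro double_domination_number_attained(2) pair_graph_lexicographic_product
        no_isolated_lexicographic_product)
  then show ?thesis
    by (simp add: card_cartesian_product)
qed

theorem theorem2p11:
  fixes G :: "'a pair_pre_digraph" and n :: nat
  assumes "pair_graph G" and "pverts G \<noteq> {}"
    and "2 \<le> min_degree G" and "card (pverts G) = n"
  shows "(\<forall>H :: 'b pair_pre_digraph. pair_graph H \<and> pverts H \<noteq> {} \<longrightarrow>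
            double_domination_number (lexicographic_product G H) \<le> double_total_domination_number G) \<and>
         (\<forall>H :: 'b pair_pre_digraph. pair_graph H \<and> pverts H \<noteq> {} \<longrightarrow>
            double_domination_number (lexicographic_product G H) \<le> n)"
  \<comment> \<open>S is a set attaining \<open>double_total_domination_number G\<close> for the
    first bound, and \<open>pverts G\<close> for the second.\<close>
  using assms double_domination_number_lexicographic_product_le[OF assms(1-3)]
    double_total_domination_number_attained(1)[OF assms(1-3)]
    double_total_dominating_set_pverts[OF assms(1-3)]
  by metis

end
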